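(* Let $\mathcal F$ be a fixed set of functions of $\theta$ and let $\tau\in\tau_{(n)}(\mathcal F)$ be a term of degree $n$. Then $\mathfrak c\tau$ (that is, each of $\mathfrak a\tau$ and $\mathfrak b\tau$) can be expressed as a sum of terms of degree $n+1$, i.e. of elements of $\tau_{(n+1)}(\mathcal F)$.
   Context: Functions are (smooth) axisymmetric functions on the sphere, depending only on the polar angle $\theta\in[0,\pi]$. Define $\mathfrak a=\partial_\theta^2$ and $\mathfrak b=\cot\theta\,\partial_\theta$; $\mathfrak c$ denotes either $\mathfrak a$ or $\mathfrak b$; $\mathfrak c^l$ denotes any composition $\mathfrak c_1\cdots\mathfrak c_l$ where each $\mathfrak c_i$ is $\mathfrak a$ or $\mathfrak b$. The family $\mathfrak d^l$ is $\mathfrak c^{l/2}$ if $l$ is even and $\partial_\theta\mathfrak c^{(l-1)/2}$ if $l$ is odd. For a fixed set of functions $\mathcal F$, $\tau_{(n)}=\tau_{(n)}(\mathcal F)$ is the family of terms of the form $$\mathfrak d^{i_1}f_1\cdots\mathfrak d^{i_k}f_k,\qquad f_1,\dots,f_k\in\mathcal F,\quad i_1+\dots+i_k=2n,$$ (where each $\mathfrak d^{i_j}$ stands for some operator of that family); such a term is said to have degree $n$. *)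

theory Defs
  imports "HOL-Analysis.Analysis"
begin

primrec Ck_on :: "nat \<Rightarrow> 'a::real_normed_vector set \<Rightarrow> ('a \<Rightarrow> real) \<Rightarrow> bool" where
  "Ck_on 0 U u \<longleftrightarrow> continuous_on U u"
| "Ck_on (Suc k) U u \<longleftrightarrow>
     (\<forall>x\<in>U. u differentiable (at x)) \<and>
     (\<forall>v. Ck_on k U (\<lambda>x. frechet_derivative u (at x) v))"

definition smooth_on :: "'a::real_normed_vector set \<Rightarrow> ('a \<Rightarrow> real) \<Rightarrow> bool" where
  "smooth_on U u \<longleftrightarrow> open U \<and> (\<forall>k. Ck_on k U u)"

definition sph :: "real \<Rightarrow> real \<Rightarrow> real^3" where
  "sph \<theta> \<phi> = vector [sin \<theta> * cos \<phi>, sin \<theta> * sin \<phi>, cos \<theta>]"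

text \<open>A function of the polar angle is a total function on the reals of which only the values
  on the interval from 0 to pi matter. It is a smooth axisymmetric function if it comes from a
  smooth function on the unit sphere, poles included; smooth on the sphere means that it is the
  restriction of a smooth function on an open neighbourhood of the sphere.\<close>

definition smooth_axisymmetric :: "(real \<Rightarrow> real) \<Rightarrow> bool" where
  "smooth_axisymmetric f \<longleftrightarrow>
     (\<exists>(u :: real^3 \<Rightarrow> real) U. sphere 0 1 \<subseteq> U \<and> smooth_on U u \<and>
        (\<forall>\<theta>\<in>{0..pi}. \<forall>\<phi>. u (sph \<theta> \<phi>) = f \<theta>))"

text \<open>The derivative in the polar angle is one-sided at the poles.\<close>

definition d_theta :: "(real \<Rightarrow> real) \<Rightarrow> real \<Rightarrow> real" where
  "d_theta f \<theta> = vector_derivative f (at \<theta> within {0..pi})"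

definition op_a :: "(real \<Rightarrow> real) \<Rightarrow> real \<Rightarrow> real" where
  "op_a f = d_theta (d_theta f)"

text \<open>The factor cot is singular at the poles, where the library value is the junk value 0.
  On smooth axisymmetric functions the product with the derivative extends continuously to the
  poles, and the operator takes the value of that extension there.\<close>

definition op_b :: "(real \<Rightarrow> real) \<Rightarrow> real \<Rightarrow> real" where
  "op_b f \<theta> =
     (if \<theta> \<in> {0<..<pi} then cot \<theta> * d_theta f \<theta>
      else Lim (at \<theta> within {0<..<pi}) (\<lambda>t. cot t * d_theta f t))"

primrec c_ops :: "nat \<Rightarrow> ((real \<Rightarrow> real) \<Rightarrow> real \<Rightarrow> real) set" where
  "c_ops 0 = {id}"
| "c_ops (Suc l) = {c \<circ> P | c P. c \<in> {op_a, op_b} \<and> P \<in> c_ops l}"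

definition d_ops :: "nat \<Rightarrow> ((real \<Rightarrow> real) \<Rightarrow> real \<Rightarrow> real) set" where
  "d_ops l = (if even l then c_ops (l div 2) else {d_theta \<circ> P | P. P \<in> c_ops ((l - 1) div 2)})"

definition tau_terms :: "nat \<Rightarrow> (real \<Rightarrow> real) set \<Rightarrow> (real \<Rightarrow> real) set" where
  "tau_terms n F =
     {\<lambda>\<theta>. \<Prod>j<k. D j (f j) \<theta> | (k::nat) i D f.
        1 \<le> k \<and> (\<forall>j<k. f j \<in> F \<and> D j \<in> d_ops (i j)) \<and> (\<Sum>j<k. i j) = 2 * n}"

end

theory Submission
  imports Defs
begin

text \<open>A smooth axisymmetric function extends along a great circle to a smooth function on the
  line that is symmetric about every multiple of \<open>\<pi>\<close>. This class is stable under both operators: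
  for \<open>cot \<theta> \<partial>\<^sub>\<theta>\<close>, the derivative is odd about the zeros of the sine, so the quotient by the sine is smooth
  by Hadamard's lemma. Hence all factors of all terms are smooth up to the poles, where identities
  extend by continuity, and the Leibniz rule applies. Each factor that is differentiated once more
  stays in the family \<open>d\<close>, and a factor \<open>cot \<theta>\<close> is absorbed by a first derivative of something in
  the family \<open>c\<close>: by the differentiated factor itself if its order was even, and otherwise by
  a second factor of odd order, which exists because the total order is even.\<close>

subsection \<open>Functions of class Ck\<close>

lemma has_derivative_frechet:
  assumes "Ck_on (Suc k) U u" "x \<in> U"
  shows "(u has_derivative frechet_derivative u (at x)) (at x)"
  using assms by (simp add: frechet_derivative_works[symmetric])

text \<open>\<open>frechet_derivative u (at x)\<close> is known to be \<open>D x\<close> only for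
  \<open>x\<close> in \<open>U\<close>, and congruence on \<open>U\<close> is itself derived from
  this rule. So the second premise covers every \<open>w\<close> that agrees with the derivative on
  \<open>U\<close>.\<close>

lemma Ck_on_SucI:
  assumes "\<And>x. x \<in> U \<Longrightarrow> (u has_derivative D x) (at x)"
    and "\<And>v w. (\<And>x. x \<in> U \<Longrightarrow> w x = D x v) \<Longrightarrow> Ck_on k U w"
  shows "Ck_on (Suc k) U u"
proof -
  have "frechet_derivative u (at x) = D x" if "x \<in> U" for x
    using frechet_derivative_at[OF assms(1)[OF that]] by simp
  then show ?thesis
    using assms by (auto simp: differentiable_def)
qed

lemma Ck_on_cong:
  assumes "open U" "Ck_on k U u" "\<And>x. x \<in> U \<Longrightarrow> w x = u x"
  shows "Ck_on k U w"
  using assms(2,3)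
proof (induction k arbitrary: u w)
  case 0
  then show ?case by (simp cong: continuous_on_cong)
next
  case (Suc k)
  have "(w has_derivative frechet_derivative u (at x)) (at x)" if "x \<in> U" for x
    using has_derivative_transform_within_open[OF has_derivative_frechet[OF Suc.prems(1) that] assms(1) that]
      Suc.prems(2) by metis
  moreover have "Ck_on k U w'" if "\<And>x. x \<in> U \<Longrightarrow> w' x = frechet_derivative u (at x) v" for w' v
    using Suc.IH[OF _ that] Suc.prems(1) by simp
  ultimately show ?case by (rule Ck_on_SucI)
qed

lemma Ck_on_SucI_open:
  assumes "open U" "\<And>x. x \<in> U \<Longrightarrow> (u has_derivative D x) (at x)"
    and "\<And>v. Ck_on k U (\<lambda>x. D x v)"
  shows "Ck_on (Suc k) U u"
  using assms(2) Ck_on_cong[OF assms(1) assms(3)] by (rule Ck_on_SucI)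

lemma Ck_on_Suc_imp: "Ck_on (Suc k) U u \<Longrightarrow> Ck_on k U u"
proof (induction k arbitrary: u)
  case 0
  then show ?case
    by (auto intro!: continuous_at_imp_continuous_on differentiable_imp_continuous_within)
next
  case (Suc k)
  have "\<forall>x\<in>U. u differentiable (at x)"
    and "\<And>v. Ck_on (Suc k) U (\<lambda>x. frechet_derivative u (at x) v)"
    using Suc.prems unfolding Ck_on.simps(2)[of "Suc k"] by blast+
  with Suc.IH show ?case unfolding Ck_on.simps(2)[of k] by blast
qed

lemma Ck_on_imp_continuous: "Ck_on k U u \<Longrightarrow> continuous_on U u"
proof (induction k)
  case (Suc k)
  then show ?case using Ck_on_Suc_imp by blast
qed simp

text \<open>Gluing: differentiability at a point is local, and the iterated derivatives do not
  depend on the neighbourhood chosen. This serves a quotient that has different smooth formulas near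
  different points.\<close>

lemma Ck_on_local:
  assumes "\<And>p. p \<in> S \<Longrightarrow> \<exists>U. open U \<and> p \<in> U \<and> Ck_on k U u"
  shows "Ck_on k S u"
  using assms
proof (induction k arbitrary: u)
  case 0
  then have "isCont u p" if "p \<in> S" for p
    using that continuous_on_eq_continuous_at by fastforce
  then show ?case by (simp add: continuous_at_imp_continuous_on)
next
  case (Suc k)
  have "\<exists>U. open U \<and> p \<in> U \<and> Ck_on k U (\<lambda>x. frechet_derivative u (at x) v)" if "p \<in> S" for p v
    using Suc.prems[OF that] by auto
  moreover have "u differentiable (at p)" if "p \<in> S" for p
    using Suc.prems[OF that] by auto
  ultimately show ?case using Suc.IH by simp
qed

lemma Ck_on_subset: "Ck_on k U u \<Longrightarrow> S \<subseteq> U \<Longrightarrow> Ck_on k S u"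
proof (induction k arbitrary: u)
  case 0
  then show ?case using continuous_on_subset by auto
next
  case (Suc k)
  then show ?case unfolding Ck_on.simps(2) by blast
qed

section \<open>Algebra of functions of class Ck\<close>

lemma Ck_on_const: "open U \<Longrightarrow> Ck_on k U (\<lambda>x. c)"
proof (induction k arbitrary: c)
  case (Suc k)
  then show ?case by (intro Ck_on_SucI_open[where D = "\<lambda>x v. 0"]) auto
qed simp

lemma Ck_on_add:
  assumes "open U" "Ck_on k U u" "Ck_on k U w"
  shows "Ck_on k U (\<lambda>x. u x + w x)"
  using assms(2,3)
proof (induction k arbitrary: u w)
  case 0
  then show ?case by (auto intro: continuous_intros)
next
  case (Suc k)
  have "Ck_on k U (\<lambda>x. frechet_derivative u (at x) v + frechet_derivative w (at x) v)" for v
    using Suc.prems by (intro Suc.IH) simp_all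
  then show ?case
    by (intro Ck_on_SucI_open[OF assms(1) has_derivative_add[OF Suc.prems[THEN has_derivative_frechet]]])
qed

lemma Ck_on_mult:
  assumes "open U" "Ck_on k U u" "Ck_on k U w"
  shows "Ck_on k U (\<lambda>x. u x * w x)"
  using assms(2,3)
proof (induction k arbitrary: u w)
  case 0
  then show ?case by (auto intro: continuous_intros)
next
  case (Suc k)
  have "Ck_on k U (\<lambda>x. u x * frechet_derivative w (at x) v + frechet_derivative u (at x) v * w x)" for v
    using Suc.prems[THEN Ck_on_Suc_imp] Suc.prems by (intro Ck_on_add assms(1) Suc.IH) simp_all
  then show ?case
    by (intro Ck_on_SucI_open[OF assms(1) has_derivative_mult[OF Suc.prems[THEN has_derivative_frechet]]])
qed

lemma Ck_on_inverse:
  assumes "open U" "Ck_on k U u" "\<And>x. x \<in> U \<Longrightarrow> u x \<noteq> 0"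
  shows "Ck_on k U (\<lambda>x. inverse (u x))"
  using assms(2)
proof (induction k)
  case 0
  then show ?case using assms(3) by (auto intro!: continuous_intros)
next
  case (Suc k)
  have inv: "Ck_on k U (\<lambda>x. inverse (u x))"
    using Suc Ck_on_Suc_imp by blast
  have "Ck_on k U (\<lambda>x. (- 1) * (inverse (u x) * (frechet_derivative u (at x) v * inverse (u x))))" for v
    using Suc.prems by (intro Ck_on_mult Ck_on_const assms(1) inv) simp
  then show ?case
    by (intro Ck_on_SucI_open[OF assms(1) Deriv.has_derivative_inverse[OF assms(3) has_derivative_frechet[OF Suc.prems]]])
      (auto simp: mult.assoc)
qed

lemma Ck_on_divide:
  assumes "open U" "Ck_on k U u" "Ck_on k U w" "\<And>x. x \<in> U \<Longrightarrow> w x \<noteq> 0"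
  shows "Ck_on k U (\<lambda>x. u x / w x)"
  unfolding divide_inverse using assms by (intro Ck_on_mult Ck_on_inverse)

section \<open>Functions of one real variable: circles and parameter integrals\<close>

lemma Ck_on_Suc_realI:
  fixes u :: "real \<Rightarrow> real"
  assumes "open U" "\<And>x. x \<in> U \<Longrightarrow> (u has_real_derivative u' x) (at x)" "Ck_on k U u'"
  shows "Ck_on (Suc k) U u"
  by (rule Ck_on_SucI_open[OF assms(1) assms(2)[unfolded has_field_derivative_def]])
    (assumption | intro Ck_on_mult Ck_on_const assms)+

lemma Ck_on_Suc_realD:
  fixes u :: "real \<Rightarrow> real"
  assumes "open U" "Ck_on (Suc k) U u"
  shows "x \<in> U \<Longrightarrow> (u has_real_derivative deriv u x) (at x)" "Ck_on k U (deriv u)"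
proof -
  have "u differentiable (at x)" if "x \<in> U" for x
    using assms(2) that unfolding Ck_on.simps(2) by blast
  then show D: "(u has_real_derivative deriv u x) (at x)" if "x \<in> U" for x
    using that unfolding DERIV_deriv_iff_real_differentiable by blast
  have "deriv u x = frechet_derivative u (at x) 1" if "x \<in> U" for x
    using fun_cong[OF frechet_derivative_at[OF D[OF that, unfolded has_field_derivative_def]], of 1]
    by simp
  moreover have "Ck_on k U (\<lambda>x. frechet_derivative u (at x) 1)"
    using assms(2) unfolding Ck_on.simps(2) by blast
  ultimately show "Ck_on k U (deriv u)"
    using Ck_on_cong[OF assms(1)] by blast
qed

lemma Ck_on_sin_cos:
  "Ck_on k UNIV (sin :: real \<Rightarrow> real)" "Ck_on k UNIV (cos :: real \<Rightarrow> real)"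
proof (induction k)
  case (Suc k)
  have "Ck_on k UNIV (\<lambda>x::real. (- 1) * sin x)"
    by (intro Ck_on_mult Ck_on_const Suc) auto
  then show "Ck_on (Suc k) UNIV (cos :: real \<Rightarrow> real)"
    by (intro Ck_on_Suc_realI[where u' = "\<lambda>x. (- 1) * sin x"]) (auto intro!: derivative_eq_intros)
  show "Ck_on (Suc k) UNIV (sin :: real \<Rightarrow> real)"
    by (intro Ck_on_Suc_realI[where u' = cos] Suc) (auto intro!: derivative_eq_intros)
qed (auto intro: continuous_intros)

text \<open>The chain rule yields derivatives of \<open>u\<close> in the fixed directions
  \<open>a\<close> and \<open>b\<close>, evaluated on the same curve, with coefficients
  \<open>cos t\<close> and \<open>- sin t\<close>. Induction over all \<open>u\<close> therefore
  closes.\<close>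

lemma Ck_on_great_circle:
  fixes a b :: "'a :: real_normed_vector"
  assumes "open U" "Ck_on k U u" "\<And>t. sin t *\<^sub>R a + cos t *\<^sub>R b \<in> U"
  shows "Ck_on k UNIV (\<lambda>t::real. u (sin t *\<^sub>R a + cos t *\<^sub>R b))"
  using assms(2)
proof (induction k arbitrary: u)
  case 0
  have "continuous_on UNIV (u \<circ> (\<lambda>t. sin t *\<^sub>R a + cos t *\<^sub>R b))"
    by (rule continuous_on_compose)
      (use 0 assms(3) in \<open>auto intro!: continuous_intros elim: continuous_on_subset\<close>)
  then show ?case by (simp add: o_def)
next
  case (Suc k)
  define \<gamma> where "\<gamma> = (\<lambda>t. sin t *\<^sub>R a + cos t *\<^sub>R b)"
  define D where "D v t = frechet_derivative u (at (\<gamma> t)) v" for v t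
  have D: "Ck_on k UNIV (D v)" for v
    using Suc.IH[of "\<lambda>x. frechet_derivative u (at x) v"] Suc.prems
    by (simp add: D_def[abs_def] \<gamma>_def)
  have Du: "(u has_derivative (\<lambda>v. D v t)) (at (\<gamma> t))" for t
    using has_derivative_frechet[OF Suc.prems assms(3)] by (simp add: D_def \<gamma>_def)
  show ?case
  proof (rule Ck_on_Suc_realI[where u' = "\<lambda>t. cos t * D a t + (- 1) * (sin t * D b t)"])
    show "((\<lambda>t. u (sin t *\<^sub>R a + cos t *\<^sub>R b)) has_real_derivative
        cos t * D a t + (- 1) * (sin t * D b t)) (at t)" for t
    proof -
      have "(\<gamma> has_derivative (\<lambda>h. (h * cos t) *\<^sub>R a - (h * sin t) *\<^sub>R b)) (at t)"
        unfolding \<gamma>_def by (auto intro!: derivative_eq_intros)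
      from has_derivative_compose[OF this Du]
      have "((\<lambda>t. u (\<gamma> t)) has_derivative
          (\<lambda>h. D ((h * cos t) *\<^sub>R a - (h * sin t) *\<^sub>R b) t)) (at t)" .
      moreover have lin: "linear (\<lambda>v. D v t)"
        using Du has_derivative_linear by blast
      have "D ((h * cos t) *\<^sub>R a - (h * sin t) *\<^sub>R b) t
          = (cos t * D a t + (- 1) * (sin t * D b t)) * h" for h
        by (simp add: linear_diff[OF lin] linear_scale[OF lin] algebra_simps)
      ultimately show ?thesis
        by (simp add: has_field_derivative_def \<gamma>_def)
    qed
  qed (intro Ck_on_add Ck_on_mult Ck_on_const Ck_on_sin_cos D open_UNIV)+
qed

text \<open>Differentiation under the integral sign brings out one factor \<open>t\<close> each
  time; the power \<open>t ^ m\<close> makes the statement stable under this.\<close>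

lemma Ck_on_integral_segment:
  fixes g :: "real \<Rightarrow> real"
  assumes "Ck_on k UNIV g"
  shows "Ck_on k UNIV (\<lambda>x. integral {0..1} (\<lambda>t. t ^ m * g (p + t * (x - p))))"
  using assms
proof (induction k arbitrary: g m)
  case 0
  have "continuous_on (UNIV \<times> cbox 0 1) (\<lambda>(x, t). t ^ m * g (p + t * (x - p)))"
    unfolding case_prod_beta using 0 by (auto intro!: continuous_intros continuous_on_compose2[of UNIV g])
  from integral_continuous_on_param[OF this] show ?case by simp
next
  case (Suc k)
  note g = Ck_on_Suc_realD[OF open_UNIV Suc.prems]
  have cont: "continuous_on UNIV g"
    using Suc.prems by (rule Ck_on_imp_continuous)
  have cont': "continuous_on UNIV (deriv g)"
    using g(2) by (rule Ck_on_imp_continuous)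
  show ?case
  proof (rule Ck_on_Suc_realI[where u' = "\<lambda>x. integral {0..1} (\<lambda>t. t ^ Suc m * deriv g (p + t * (x - p)))"])
    fix x0 :: real
    have "((\<lambda>x. integral (cbox 0 1) (\<lambda>t. t ^ m * g (p + t * (x - p)))) has_field_derivative
        integral (cbox 0 1) (\<lambda>t. t ^ Suc m * deriv g (p + t * (x0 - p)))) (at x0 within UNIV)"
    proof (rule leibniz_rule_field_derivative[where U = UNIV])
      show "((\<lambda>x. t ^ m * g (p + t * (x - p))) has_field_derivative
          t ^ Suc m * deriv g (p + t * (x - p))) (at x within UNIV)" for x t
        by (auto intro!: derivative_eq_intros DERIV_chain2[OF g(1)])
      show "(\<lambda>t. t ^ m * g (p + t * (x - p))) integrable_on cbox 0 1" for x
        by (rule integrable_continuous)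
          (auto intro!: continuous_intros continuous_on_compose2[OF cont])
      show "continuous_on (UNIV \<times> cbox 0 1) (\<lambda>(x, t). t ^ Suc m * deriv g (p + t * (x - p)))"
        unfolding case_prod_beta by (auto intro!: continuous_intros continuous_on_compose2[OF cont'])
    qed auto
    then show "((\<lambda>x. integral {0..1} (\<lambda>t. t ^ m * g (p + t * (x - p)))) has_field_derivative
        integral {0..1} (\<lambda>t. t ^ Suc m * deriv g (p + t * (x0 - p)))) (at x0)" by simp
  qed (intro open_UNIV Suc.IH g(2))+
qed

section \<open>Smooth functions and division by the sine\<close>

lemma smooth_onD: "smooth_on U u \<Longrightarrow> Ck_on k U u"
  by (simp add: smooth_on_def)

lemma smooth_on_real_deriv:
  fixes g :: "real \<Rightarrow> real"
  assumes "smooth_on U g"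
  shows "smooth_on U (deriv g)" "x \<in> U \<Longrightarrow> (g has_real_derivative deriv g x) (at x)"
  using assms Ck_on_Suc_realD unfolding smooth_on_def by blast+

lemma smooth_on_mult: "smooth_on U u \<Longrightarrow> smooth_on U w \<Longrightarrow> smooth_on U (\<lambda>x. u x * w x)"
  by (simp add: smooth_on_def Ck_on_mult)

lemma smooth_on_prod:
  assumes "open U" "\<And>j. j < k \<Longrightarrow> smooth_on U (G j)"
  shows "smooth_on U (\<lambda>x. \<Prod>j<(k::nat). G j x)"
  using assms(2)
proof (induction k)
  case 0
  then show ?case using assms(1) by (simp add: smooth_on_def Ck_on_const)
next
  case (Suc k)
  then show ?case by (simp add: smooth_on_mult)
qed

lemma smooth_on_cos: "smooth_on UNIV (cos :: real \<Rightarrow> real)"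
  and smooth_on_sin: "smooth_on UNIV (sin :: real \<Rightarrow> real)"
  by (simp_all add: smooth_on_def Ck_on_sin_cos)

text \<open>By the fundamental theorem of calculus on the segment from \<open>p\<close> to
  \<open>x\<close>, the mean of \<open>deriv g\<close> over that segment serves as
  \<open>h\<close>.\<close>

lemma Hadamard_division:
  fixes g :: "real \<Rightarrow> real"
  assumes "smooth_on UNIV g" "g p = 0"
  obtains h where "smooth_on UNIV h" "\<And>x. g x = (x - p) * h x" "h p = deriv g p"
proof
  \<comment> \<open>The trivial factor \<open>t ^ 0\<close> matches
    \<open>Ck_on_integral_segment\<close> with \<open>m = 0\<close>.\<close>
  define h where "h x = integral {0..1} (\<lambda>t. t ^ 0 * deriv g (p + t * (x - p)))" for x
  show "smooth_on UNIV h"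
    using smooth_on_real_deriv(1)[OF assms(1)] Ck_on_integral_segment
    unfolding smooth_on_def h_def[abs_def] by blast
  show "h p = deriv g p"
    by (simp add: h_def)
  show "g x = (x - p) * h x" for x
  proof -
    have "((\<lambda>t. (x - p) * deriv g (p + t * (x - p))) has_integral
        g (p + 1 * (x - p)) - g (p + 0 * (x - p))) {0..1}"
    proof (rule fundamental_theorem_of_calculus)
      show "((\<lambda>t. g (p + t * (x - p))) has_vector_derivative (x - p) * deriv g (p + t * (x - p)))
          (at t within {0..1})" for t
      proof -
        have "((\<lambda>t. p + t * (x - p)) has_real_derivative x - p) (at t)"
          by (auto intro!: derivative_eq_intros)
        from DERIV_chain2[OF smooth_on_real_deriv(2)[OF assms(1) UNIV_I] this] show ?thesis
          unfolding has_real_derivative_iff_has_vector_derivative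
          by (simp add: mult.commute has_vector_derivative_at_within)
      qed
    qed simp
    from integral_unique[OF this] show ?thesis
      using assms(2) by (simp add: h_def)
  qed
qed

text \<open>Away from the zeros of the sine this is an ordinary quotient. At a zero
  \<open>p\<close>, Hadamard's lemma takes a factor \<open>x - p\<close> out of both
  \<open>g\<close> and \<open>sin\<close>, and it cancels; the value at \<open>p\<close> is the one
  of l'Hopital's rule.\<close>

lemma smooth_on_divide_sin:
  assumes "smooth_on UNIV g" "\<And>p. sin p = 0 \<Longrightarrow> g p = 0"
  shows "smooth_on UNIV (\<lambda>x. if sin x = 0 then deriv g x / cos x else g x / sin x)"
    (is "smooth_on UNIV ?q")
proof -
  have "\<exists>U. open U \<and> p \<in> U \<and> Ck_on k U ?q" for k p
  proof (cases "sin p = 0")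
    case False
    let ?U = "{x::real. sin x \<noteq> 0}"
    have op: "open ?U" by (intro open_Collect_neq continuous_intros)
    have "Ck_on k ?U (\<lambda>x. g x / sin x)"
      by (intro Ck_on_divide op Ck_on_subset[OF smooth_onD[OF assms(1)]]
          Ck_on_subset[OF smooth_onD[OF smooth_on_sin]]) auto
    then have "Ck_on k ?U ?q" by (rule Ck_on_cong[OF op]) auto
    with op False show ?thesis by blast
  next
    case True
    obtain h where h: "smooth_on UNIV h" "\<And>x. g x = (x - p) * h x" "h p = deriv g p"
      using Hadamard_division[OF assms(1) assms(2)[OF True]] by metis
    obtain s where s: "smooth_on UNIV s" "\<And>x. sin x = (x - p) * s x" "s p = deriv sin p"
      using Hadamard_division[OF smooth_on_sin True] by metis
    have sp: "s p = cos p"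
      using s(3) DERIV_imp_deriv[OF DERIV_sin] by simp
    \<comment> \<open>Since \<open>sin x = (x - p) * s x\<close>, the only zero of the sine that
      \<open>?U\<close> can contain is \<open>p\<close>; and it does contain \<open>p\<close>,
      because \<open>s p = cos p\<close> is nonzero.\<close>
    let ?U = "{x. s x \<noteq> 0}"
    have op: "open ?U"
      by (intro open_Collect_neq continuous_intros Ck_on_imp_continuous[OF smooth_onD[OF s(1)]])
    have "Ck_on k ?U (\<lambda>x. h x / s x)"
      by (intro Ck_on_divide op Ck_on_subset[OF smooth_onD[OF h(1)]]
          Ck_on_subset[OF smooth_onD[OF s(1)]]) auto
    moreover have "?q x = h x / s x" if "x \<in> ?U" for x
    proof (cases "x = p")
      case True
      then show ?thesis using \<open>sin p = 0\<close> h(3) sp by simp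
    next
      case False
      then show ?thesis using that by (simp add: h(2) s(2))
    qed
    ultimately have "Ck_on k ?U ?q" by (rule Ck_on_cong[OF op])
    moreover have "cos p \<noteq> 0"
      using True sin_cos_squared_add[of p] by auto
    ultimately show ?thesis using op sp by (intro exI[of _ ?U]) simp
  qed
  then show ?thesis
    unfolding smooth_on_def by (auto intro: Ck_on_local)
qed

subsection \<open>Smooth functions on the closed meridian\<close>

text \<open>An extension to the whole line turns the one-sided derivatives at the poles into
  ordinary ones.\<close>

definition smooth_ext :: "(real \<Rightarrow> real) \<Rightarrow> (real \<Rightarrow> real) \<Rightarrow> bool" where
  "smooth_ext g f \<longleftrightarrow> smooth_on UNIV g \<and> (\<forall>\<theta>\<in>{0..pi}. f \<theta> = g \<theta>)"

text \<open>Invariance under the reflections in all points of \<open>\<int>\<pi>\<close>, that is, being even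
  and \<open>2\<pi>\<close>-periodic.\<close>

definition pole_symmetric :: "(real \<Rightarrow> real) \<Rightarrow> bool" where
  "pole_symmetric g \<longleftrightarrow> (\<forall>p x. sin p = 0 \<longrightarrow> g (2 * p - x) = g x)"

lemma d_theta_eqI:
  assumes "(g has_real_derivative d) (at \<theta>)" "\<And>t. t \<in> {0..pi} \<Longrightarrow> f t = g t" "\<theta> \<in> {0..pi}"
  shows "d_theta f \<theta> = d"
proof -
  have "(g has_vector_derivative d) (at \<theta> within {0..pi})"
    using assms(1) has_real_derivative_iff_has_vector_derivative has_vector_derivative_at_within by blast
  then have "(f has_vector_derivative d) (at \<theta> within {0..pi})"
    by (rule has_vector_derivative_transform[rotated 2]) (use assms in auto)
  then show ?thesis
    unfolding d_theta_def using assms(3) by (intro vector_derivative_within_closed_interval) auto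
qed

lemma smooth_ext_d_theta:
  assumes "smooth_ext g f"
  shows "smooth_ext (deriv g) (d_theta f)"
  using assms smooth_on_real_deriv[of UNIV g] d_theta_eqI[of g _ _ f]
  unfolding smooth_ext_def by blast

lemma smooth_ext_op_a: "smooth_ext g f \<Longrightarrow> smooth_ext (deriv (deriv g)) (op_a f)"
  unfolding op_a_def by (intro smooth_ext_d_theta)

lemma smooth_ext_continuous: "smooth_ext g f \<Longrightarrow> continuous_on {0..pi} f"
  using Ck_on_imp_continuous[OF smooth_onD[of UNIV g 0]]
  unfolding smooth_ext_def by (metis continuous_on_cong continuous_on_subset subset_UNIV)

text \<open>At a pole the value of \<open>op_b f\<close> is a limit of interior values, and
  continuity of \<open>w\<close> identifies this limit.\<close>

lemma op_b_eqI:
  assumes "continuous_on {0..pi} w" "\<And>t. t \<in> {0<..<pi} \<Longrightarrow> cot t * d_theta f t = w t"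
    and "\<theta> \<in> {0..pi}"
  shows "op_b f \<theta> = w \<theta>"
proof (cases "\<theta> \<in> {0<..<pi}")
  case True
  then show ?thesis using assms(2) by (simp add: op_b_def)
next
  case False
  have "(w \<longlongrightarrow> w \<theta>) (at \<theta> within {0<..<pi})"
  proof (rule tendsto_within_subset)
    show "(w \<longlongrightarrow> w \<theta>) (at \<theta> within {0..pi})"
      using assms(1,3) by (simp add: continuous_on_def)
  qed auto
  then have "((\<lambda>t. cot t * d_theta f t) \<longlongrightarrow> w \<theta>) (at \<theta> within {0<..<pi})"
    by (rule Lim_transform_within[where d = 1]) (use assms(2) in auto)
  \<comment> \<open>The pole must be a limit point of the open interval, or the limit in
    \<open>op_b\<close> would not be unique.\<close>
  moreover have "\<theta> islimpt {0<..<pi}"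
    using assms(3) False islimpt_greaterThanLessThan1[of 0 pi] islimpt_greaterThanLessThan2[of 0 pi]
    by (cases "\<theta> = 0") auto
  ultimately show ?thesis
    using False by (auto simp: op_b_def tendsto_Lim trivial_limit_within)
qed

text \<open>Differentiating \<open>g (2 * p - x) = g x\<close> brings out a factor \<open>-1\<close>
  each time, so the parity about \<open>p\<close> alternates.\<close>

lemma pole_symmetric_deriv:
  assumes "smooth_on UNIV g" "pole_symmetric g" "sin p = 0"
  shows "deriv g (2 * p - x) = - deriv g x" "deriv (deriv g) (2 * p - x) = deriv (deriv g) x"
proof -
  have inner: "((\<lambda>x. 2 * p - x) has_real_derivative - 1) (at x)" for x
    by (auto intro!: derivative_eq_intros)
  have *: "deriv g (2 * p - x) = - deriv g x" for x
  proof -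
    have "((\<lambda>x. g (2 * p - x)) has_real_derivative deriv g (2 * p - x) * (- 1)) (at x)"
      by (rule DERIV_chain2[OF smooth_on_real_deriv(2)[OF assms(1) UNIV_I] inner])
    moreover have "(\<lambda>x. g (2 * p - x)) = g"
      using assms by (auto simp: pole_symmetric_def)
    ultimately show ?thesis
      using smooth_on_real_deriv(2)[OF assms(1), of x] DERIV_unique by fastforce
  qed
  then show "deriv g (2 * p - x) = - deriv g x" .
  note d = smooth_on_real_deriv(2)[OF smooth_on_real_deriv(1)[OF assms(1)] UNIV_I]
  have "((\<lambda>x. deriv g (2 * p - x)) has_real_derivative deriv (deriv g) (2 * p - x) * (- 1)) (at x)"
    by (rule DERIV_chain2[OF d inner])
  moreover have "((\<lambda>x. - deriv g x) has_real_derivative - deriv (deriv g) x) (at x)"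
    by (intro DERIV_minus d)
  ultimately show "deriv (deriv g) (2 * p - x) = deriv (deriv g) x"
    using DERIV_unique by (fastforce simp: *)
qed

text \<open>A smooth extension alone would not be preserved by \<open>op_b\<close>: for the function
  \<open>\<theta>\<close> itself, \<open>cot\<close> times the derivative blows up at the poles. The
  symmetry forces the derivative to vanish there.\<close>

definition smooth_polar :: "(real \<Rightarrow> real) \<Rightarrow> bool" where
  "smooth_polar f \<longleftrightarrow> (\<exists>g. smooth_ext g f \<and> pole_symmetric g)"

lemma smooth_polar_op_a:
  assumes "smooth_polar f"
  shows "smooth_polar (op_a f)"
proof -
  obtain g where g: "smooth_ext g f" "pole_symmetric g"
    using assms smooth_polar_def by blast
  then have "pole_symmetric (deriv (deriv g))"
    using pole_symmetric_deriv(2) unfolding pole_symmetric_def[of "deriv (deriv g)"] smooth_ext_def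
    by blast
  with smooth_ext_op_a[OF g(1)] show ?thesis
    unfolding smooth_polar_def by blast
qed

lemma smooth_polar_op_b:
  assumes "smooth_polar f"
  shows "smooth_polar (op_b f)"
proof -
  obtain g where g: "smooth_ext g f" "pole_symmetric g"
    using assms smooth_polar_def by blast
  then have sm: "smooth_on UNIV g" by (simp add: smooth_ext_def)
  note refl = pole_symmetric_deriv[OF sm g(2)]
  define q where "q x = (if sin x = 0 then deriv (deriv g) x / cos x else deriv g x / sin x)" for x
  \<comment> \<open>The reflection fixes \<open>p\<close>, so oddness reads
    \<open>deriv g p = - deriv g p\<close>.\<close>
  have "deriv g p = 0" if "sin p = 0" for p
    using refl(1)[OF that, of p] by simp
  then have "smooth_on UNIV q"
    unfolding q_def[abs_def] by (intro smooth_on_divide_sin smooth_on_real_deriv sm)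
  then have smq: "smooth_on UNIV (\<lambda>x. cos x * q x)"
    by (intro smooth_on_mult smooth_on_cos)
  have "cot t * d_theta f t = cos t * q t" if "t \<in> {0<..<pi}" for t
  proof -
    have "d_theta f t = deriv g t"
      using smooth_ext_d_theta[OF g(1)] that by (simp add: smooth_ext_def)
    moreover have "sin t \<noteq> 0" using that sin_gt_zero[of t] by auto
    ultimately show ?thesis by (simp add: cot_def q_def)
  qed
  moreover have "continuous_on {0..pi} (\<lambda>x. cos x * q x)"
    using Ck_on_imp_continuous[OF smooth_onD[OF smq, of 0]] continuous_on_subset by blast
  ultimately have "smooth_ext (\<lambda>x. cos x * q x) (op_b f)"
    using smq op_b_eqI unfolding smooth_ext_def by blast
  moreover have "pole_symmetric (\<lambda>x. cos x * q x)"
    unfolding pole_symmetric_def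
  proof (intro allI impI)
    fix p x :: real
    assume p: "sin p = 0"
    \<comment> \<open>Under the reflection \<open>sin\<close> and \<open>deriv g\<close> change sign
      while \<open>cos\<close> and the second derivative do not, so both branches of
      \<open>q\<close> are invariant.\<close>
    then have "cos (2 * p) = 1" "sin (2 * p) = 0"
      by (simp_all add: cos_double_sin sin_double)
    then show "cos (2 * p - x) * q (2 * p - x) = cos x * q x"
      by (simp add: q_def refl[OF p] sin_diff cos_diff)
  qed
  ultimately show ?thesis unfolding smooth_polar_def by blast
qed

lemma smooth_axisymmetric_imp_smooth_polar:
  assumes "smooth_axisymmetric f"
  shows "smooth_polar f"
proof -
  obtain u :: "real^3 \<Rightarrow> real" and U where U: "sphere 0 1 \<subseteq> U" "smooth_on U u"
    and u: "\<And>\<theta> \<phi>. \<theta> \<in> {0..pi} \<Longrightarrow> u (sph \<theta> \<phi>) = f \<theta>"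
    using assms unfolding smooth_axisymmetric_def by blast
  \<comment> \<open>The smooth extension comes from following the whole great circle through both
    poles, past the half that is parametrized by the polar angle.\<close>
  define g where "g t = u (sph t 0)" for t
  have sph0: "sph t 0 = sin t *\<^sub>R axis 1 1 + cos t *\<^sub>R axis 3 1" for t
    by (simp add: sph_def vec_eq_iff forall_3 axis_def)
  have "sph t 0 \<in> sphere 0 1" for t
    by (simp add: sph_def norm_vec_def L2_set_def sum_3)
  then have "smooth_on UNIV g"
    using U unfolding smooth_on_def g_def[abs_def] sph0
    by (auto intro!: Ck_on_great_circle)
  then have "smooth_ext g f"
    by (simp add: smooth_ext_def g_def u)
  \<comment> \<open>The point \<open>sph t 0\<close> has polar angle \<open>arccos (cos t)\<close>
    and longitude 0 or \<open>pi\<close>, according to the sign of \<open>sin t\<close>. Axisymmetry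
    thus makes \<open>g\<close> a function of \<open>cos t\<close> alone.\<close>
  have g_arccos: "g t = f (arccos (cos t))" for t
  proof -
    let ?\<theta> = "arccos (cos t)"
    have c: "cos ?\<theta> = cos t" and th: "?\<theta> \<in> {0..pi}"
      by (simp_all add: arccos_lbound arccos_ubound)
    have "sin ?\<theta> ^ 2 = sin t ^ 2"
      by (simp add: sin_squared_eq c)
    then consider "sin t = sin ?\<theta>" | "sin t = - sin ?\<theta>"
      by (metis power2_eq_iff)
    then have "sph t 0 = sph ?\<theta> 0 \<or> sph t 0 = sph ?\<theta> pi"
      by cases (simp_all only: sph_def c cos_zero sin_zero cos_pi sin_pi, simp_all)
    then show ?thesis
      using u[OF th] by (auto simp: g_def)
  qed
  \<comment> \<open>If \<open>sin p = 0\<close>, then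
    \<open>cos (2 * p - x) = cos x\<close>.\<close>
  have "pole_symmetric g"
    unfolding pole_symmetric_def
    by (simp add: g_arccos cos_diff cos_double_sin sin_double)
  with \<open>smooth_ext g f\<close> show ?thesis
    unfolding smooth_polar_def by blast
qed

subsection \<open>Terms\<close>

lemma smooth_polar_c_ops:
  assumes "P \<in> c_ops l" "smooth_polar f"
  shows "smooth_polar (P f)"
  using assms(1)
proof (induction l arbitrary: P)
  case 0
  then show ?case using assms(2) by simp
next
  case (Suc l)
  then obtain c Q where "P = c \<circ> Q" "c \<in> {op_a, op_b}" "Q \<in> c_ops l"
    by auto
  with Suc.IH[of Q] show ?case
    by (auto simp: smooth_polar_op_a smooth_polar_op_b)
qed

text \<open>The conclusion is \<open>smooth_ext\<close> and not \<open>smooth_polar\<close>, since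
  for odd \<open>i\<close> the outermost derivative turns symmetry about the poles into
  antisymmetry.\<close>

lemma smooth_ext_d_ops:
  assumes "D \<in> d_ops i" "smooth_polar f"
  shows "\<exists>g. smooth_ext g (D f)"
proof (cases "even i")
  case True
  then show ?thesis
    using assms smooth_polar_c_ops[of D] by (auto simp: d_ops_def smooth_polar_def)
next
  case False
  then obtain P where "P \<in> c_ops ((i - 1) div 2)" "D = d_theta \<circ> P"
    using assms by (auto simp: d_ops_def)
  then show ?thesis
    using smooth_polar_c_ops[of P] assms(2) smooth_ext_d_theta
    by (fastforce simp: smooth_polar_def)
qed

text \<open>For odd order the new derivative merges with the outermost one into
  \<open>op_a\<close>.\<close>

lemma d_theta_d_ops:
  assumes "D \<in> d_ops i"
  shows "d_theta \<circ> D \<in> d_ops (Suc i)"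
proof (cases "even i")
  case True
  then show ?thesis using assms by (auto simp: d_ops_def)
next
  case False
  then obtain P where P: "P \<in> c_ops ((i - 1) div 2)" "D = d_theta \<circ> P"
    using assms by (auto simp: d_ops_def)
  moreover have "d_theta \<circ> D = op_a \<circ> P"
    by (simp add: P(2) op_a_def fun_eq_iff)
  moreover have "Suc i div 2 = Suc ((i - 1) div 2)"
    using False by presburger
  ultimately show ?thesis using False by (auto simp: d_ops_def)
qed

lemma op_b_d_ops:
  assumes "even i" "D \<in> d_ops i"
  shows "op_b \<circ> D \<in> d_ops (Suc (Suc i))"
  using assms by (auto simp: d_ops_def)

text \<open>Multiplying \<open>d_theta (P f)\<close> by \<open>cot\<close> gives
  \<open>op_b (P f)\<close> between the poles, so an operator of odd order absorbs a cotangent at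
  the cost of one order.\<close>

lemma op_b_odd_d_ops:
  assumes "odd i" "D \<in> d_ops i"
  obtains P where "D = d_theta \<circ> P" "op_b \<circ> P \<in> d_ops (Suc i)"
proof -
  obtain P where P: "P \<in> c_ops ((i - 1) div 2)" "D = d_theta \<circ> P"
    using assms by (auto simp: d_ops_def)
  moreover have "Suc i div 2 = Suc ((i - 1) div 2)"
    using assms(1) by presburger
  ultimately have "op_b \<circ> P \<in> d_ops (Suc i)"
    using assms(1) by (auto simp: d_ops_def)
  with P(2) show thesis by (rule that)
qed

text \<open>Like \<^const>\<open>tau_terms\<close>, but graded by the total order of the operators, which may be odd.\<close>

definition order_terms :: "nat \<Rightarrow> (real \<Rightarrow> real) set \<Rightarrow> (real \<Rightarrow> real) set" where
  "order_terms s F =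
     {\<lambda>\<theta>. \<Prod>j<k. D j (f j) \<theta> | (k::nat) i D f.
        1 \<le> k \<and> (\<forall>j<k. f j \<in> F \<and> D j \<in> d_ops (i j)) \<and> (\<Sum>j<k. i j) = s}"

lemma tau_terms_eq: "tau_terms n F = order_terms (2 * n) F"
  by (simp add: tau_terms_def order_terms_def)

lemma order_termsI:
  assumes "1 \<le> (k::nat)" "\<And>j. j < k \<Longrightarrow> f j \<in> F" "\<And>j. j < k \<Longrightarrow> D j \<in> d_ops (i j)"
    and "(\<Sum>j<k. i j) = s"
  shows "(\<lambda>\<theta>. \<Prod>j<k. D j (f j) \<theta>) \<in> order_terms s F"
  unfolding order_terms_def mem_Collect_eq
  by (intro exI[of _ k] exI[of _ i] exI[of _ D] exI[of _ f]) (use assms in auto)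

lemma order_termsE:
  assumes "h \<in> order_terms s F"
  obtains k i D f where "1 \<le> (k::nat) \<and> (\<forall>j<k. f j \<in> F \<and> D j \<in> d_ops (i j)) \<and> (\<Sum>j<k. i j) = s \<and>
    h = (\<lambda>\<theta>. \<Prod>j<k. D j (f j) \<theta>)"
proof -
  have "\<exists>k i D f. 1 \<le> (k::nat) \<and> (\<forall>j<k. f j \<in> F \<and> D j \<in> d_ops (i j)) \<and> (\<Sum>j<k. i j) = s \<and>
      h = (\<lambda>\<theta>. \<Prod>j<k. D j (f j) \<theta>)"
    using assms unfolding order_terms_def mem_Collect_eq by (elim exE conjE) (intro exI conjI, assumption+)
  then show thesis by (elim exE) (rule that)
qed

section \<open>Differentiation of products and sums of terms\<close>

lemma smooth_ext_prod:
  assumes "\<And>j. j < k \<Longrightarrow> \<exists>g. smooth_ext g (H j)"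
  shows "\<exists>g. smooth_ext g (\<lambda>\<theta>. \<Prod>j<(k::nat). H j \<theta>)"
proof -
  obtain G where "\<And>j. j < k \<Longrightarrow> smooth_ext (G j) (H j)"
    using assms by metis
  then have "smooth_ext (\<lambda>\<theta>. \<Prod>j<k. G j \<theta>) (\<lambda>\<theta>. \<Prod>j<k. H j \<theta>)"
    by (auto simp: smooth_ext_def intro!: smooth_on_prod prod.cong)
  then show ?thesis by blast
qed

lemma smooth_ext_order_terms:
  assumes "\<forall>f\<in>F. smooth_polar f" "h \<in> order_terms s F"
  shows "\<exists>g. smooth_ext g h"
proof -
  obtain k i D f where *: "1 \<le> (k::nat) \<and> (\<forall>j<k. f j \<in> F \<and> D j \<in> d_ops (i j)) \<and>
      (\<Sum>j<k. i j) = s \<and> h = (\<lambda>\<theta>. \<Prod>j<k. D j (f j) \<theta>)"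
    by (rule order_termsE[OF assms(2)])
  then have f: "\<And>j. j < k \<Longrightarrow> f j \<in> F" and D: "\<And>j. j < k \<Longrightarrow> D j \<in> d_ops (i j)"
    and h: "h = (\<lambda>\<theta>. \<Prod>j<k. D j (f j) \<theta>)"
    by simp_all
  show ?thesis
    unfolding h using smooth_ext_d_ops[OF D] assms(1) f by (intro smooth_ext_prod) blast
qed

text \<open>Expansions into terms are identities on the closed interval only; agreement there
  suffices because \<open>d_theta\<close> is taken within it.\<close>

lemma d_theta_sum:
  assumes "\<And>j. j < m \<Longrightarrow> \<exists>g. smooth_ext g (H j)" "\<theta> \<in> {0..pi}"
    and "\<And>t. t \<in> {0..pi} \<Longrightarrow> h t = (\<Sum>j<(m::nat). H j t)"
  shows "d_theta h \<theta> = (\<Sum>j<m. d_theta (H j) \<theta>)"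
proof -
  obtain G where G: "\<And>j. j < m \<Longrightarrow> smooth_ext (G j) (H j)"
    using assms(1) by metis
  have "((\<lambda>t. \<Sum>j<m. G j t) has_real_derivative (\<Sum>j<m. deriv (G j) \<theta>)) (at \<theta>)"
    using G by (intro DERIV_sum smooth_on_real_deriv(2)[of UNIV]) (auto simp: smooth_ext_def)
  then have "d_theta h \<theta> = (\<Sum>j<m. deriv (G j) \<theta>)"
    by (rule d_theta_eqI) (use G assms(2,3) in \<open>auto simp: smooth_ext_def\<close>)
  also have "\<dots> = (\<Sum>j<m. d_theta (H j) \<theta>)"
    using smooth_ext_d_theta[OF G] assms(2) by (auto simp: smooth_ext_def intro!: sum.cong)
  finally show ?thesis .
qed

lemma d_theta_prod:
  assumes "\<And>j. j < k \<Longrightarrow> \<exists>g. smooth_ext g (H j)" "\<theta> \<in> {0..pi}"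
  shows "d_theta (\<lambda>\<theta>. \<Prod>j<(k::nat). H j \<theta>) \<theta>
    = (\<Sum>l<k. d_theta (H l) \<theta> * (\<Prod>j\<in>{..<k} - {l}. H j \<theta>))"
proof -
  obtain G where G: "\<And>j. j < k \<Longrightarrow> smooth_ext (G j) (H j)"
    using assms(1) by metis
  have "((\<lambda>t. \<Prod>j<k. G j t) has_real_derivative
      (\<Sum>l<k. deriv (G l) \<theta> * (\<Prod>j\<in>{..<k} - {l}. G j \<theta>))) (at \<theta>)"
    using G by (intro has_field_derivative_prod smooth_on_real_deriv(2)[of UNIV])
      (auto simp: smooth_ext_def)
  then have "d_theta (\<lambda>\<theta>. \<Prod>j<k. H j \<theta>) \<theta> = (\<Sum>l<k. deriv (G l) \<theta> * (\<Prod>j\<in>{..<k} - {l}. G j \<theta>))"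
    by (rule d_theta_eqI) (use G assms(2) in \<open>auto simp: smooth_ext_def\<close>)
  also have "\<dots> = (\<Sum>l<k. d_theta (H l) \<theta> * (\<Prod>j\<in>{..<k} - {l}. H j \<theta>))"
    using G smooth_ext_d_theta[OF G] assms(2)
    by (auto simp: smooth_ext_def intro!: sum.cong arg_cong2[of _ _ _ _ "(*)"] prod.cong)
  finally show ?thesis .
qed

text \<open>The set \<open>A\<close> is a parameter because expansions that involve
  \<open>cot\<close> are first obtained between the poles and only then extended to them.\<close>

definition sum_of_terms :: "(real \<Rightarrow> real) set \<Rightarrow> real set \<Rightarrow> (real \<Rightarrow> real) \<Rightarrow> bool" where
  "sum_of_terms S A h \<longleftrightarrow> (\<exists>(m::nat) \<sigma>. 1 \<le> m \<and> (\<forall>j<m. \<sigma> j \<in> S) \<and>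
     (\<forall>\<theta>\<in>A. h \<theta> = (\<Sum>j<m. \<sigma> j \<theta>)))"

lemma sum_of_termsI:
  assumes "1 \<le> (m::nat)" "\<And>j. j < m \<Longrightarrow> \<sigma> j \<in> S" "\<And>\<theta>. \<theta> \<in> A \<Longrightarrow> h \<theta> = (\<Sum>j<m. \<sigma> j \<theta>)"
  shows "sum_of_terms S A h"
  unfolding sum_of_terms_def by (intro exI[of _ m] exI[of _ \<sigma>]) (use assms in auto)

lemma sum_of_terms_base: "\<sigma> \<in> S \<Longrightarrow> (\<And>\<theta>. \<theta> \<in> A \<Longrightarrow> h \<theta> = \<sigma> \<theta>) \<Longrightarrow> sum_of_terms S A h"
  by (rule sum_of_termsI[of 1 "\<lambda>_. \<sigma>"]) simp_all

lemma sum_of_terms_add: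
  assumes "sum_of_terms S A g" "sum_of_terms S A h"
  shows "sum_of_terms S A (\<lambda>\<theta>. g \<theta> + h \<theta>)"
proof -
  obtain m \<sigma> where m: "1 \<le> (m::nat)" "\<And>j. j < m \<Longrightarrow> \<sigma> j \<in> S" "\<And>\<theta>. \<theta> \<in> A \<Longrightarrow> g \<theta> = (\<Sum>j<m. \<sigma> j \<theta>)"
    using assms(1) unfolding sum_of_terms_def by blast
  obtain m' \<sigma>' where m': "1 \<le> (m'::nat)" "\<And>j. j < m' \<Longrightarrow> \<sigma>' j \<in> S" "\<And>\<theta>. \<theta> \<in> A \<Longrightarrow> h \<theta> = (\<Sum>j<m'. \<sigma>' j \<theta>)"
    using assms(2) unfolding sum_of_terms_def by blast
  define \<rho> where "\<rho> j = (if j < m then \<sigma> j else \<sigma>' (j - m))" for j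
  have "(\<Sum>j<m + n. \<rho> j \<theta>) = (\<Sum>j<m. \<sigma> j \<theta>) + (\<Sum>j<n. \<sigma>' j \<theta>)" for n \<theta>
    by (induction n) (simp_all add: \<rho>_def)
  then show ?thesis
    using m m' by (intro sum_of_termsI[of "m + m'" \<rho>]) (auto simp: \<rho>_def)
qed

lemma sum_of_terms_sum:
  assumes "1 \<le> (m::nat)" "\<And>j. j < m \<Longrightarrow> sum_of_terms S A (h j)"
    and "\<And>\<theta>. \<theta> \<in> A \<Longrightarrow> g \<theta> = (\<Sum>j<m. h j \<theta>)"
  shows "sum_of_terms S A g"
proof -
  have "sum_of_terms S A (\<lambda>\<theta>. \<Sum>j<m. h j \<theta>)"
    using assms(1,2)
  proof (induction m rule: dec_induct)
    case base
    then show ?case by simp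
  next
    case (step m)
    then show ?case by (auto intro: sum_of_terms_add)
  qed
  then show ?thesis using assms(3) by (simp add: sum_of_terms_def)
qed

section \<open>Action of the operators on terms\<close>

lemma prod_update:
  assumes "l < (k::nat)"
  shows "(\<Prod>j<k. (D(l := E)) j (f j) \<theta>) = E (f l) \<theta> * (\<Prod>j\<in>{..<k} - {l}. D j (f j) \<theta>)"
  using assms by (subst prod.remove[of _ l]) (auto intro!: prod.cong)

lemma sum_update:
  assumes "l < (k::nat)"
  shows "(\<Sum>j<k. (i(l := i l + d)) j) = (\<Sum>j<k. i j) + (d::nat)"
proof -
  have "(\<Sum>j<k. (i(l := i l + d)) j) = i l + d + (\<Sum>j\<in>{..<k} - {l}. i j)"
    using assms by (subst sum.remove[of _ l]) (auto intro!: sum.cong)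
  also have "\<dots> = (\<Sum>j<k. i j) + d"
    using assms by (subst (2) sum.remove[of _ l]) auto
  finally show ?thesis .
qed

text \<open>In each Leibniz summand a single operator \<open>D l\<close> becomes
  \<open>d_theta \<circ> D l\<close>, which is again in the family, one order higher.\<close>

lemma d_theta_order_terms:
  assumes "\<forall>f\<in>F. smooth_polar f" "h \<in> order_terms s F"
  shows "sum_of_terms (order_terms (Suc s) F) {0..pi} (d_theta h)"
proof -
  obtain k i D f where *: "1 \<le> (k::nat) \<and> (\<forall>j<k. f j \<in> F \<and> D j \<in> d_ops (i j)) \<and>
      (\<Sum>j<k. i j) = s \<and> h = (\<lambda>\<theta>. \<Prod>j<k. D j (f j) \<theta>)"
    by (rule order_termsE[OF assms(2)])
  then have k: "1 \<le> k" and f: "\<And>j. j < k \<Longrightarrow> f j \<in> F" and D: "\<And>j. j < k \<Longrightarrow> D j \<in> d_ops (i j)"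
    and s: "(\<Sum>j<k. i j) = s" and h: "h = (\<lambda>\<theta>. \<Prod>j<k. D j (f j) \<theta>)"
    by simp_all
  have ext: "\<exists>g. smooth_ext g (D j (f j))" if "j < k" for j
    using smooth_ext_d_ops[OF D[OF that]] assms(1) f[OF that] by blast
  have Leibniz: "d_theta h \<theta> = (\<Sum>l<k. d_theta (D l (f l)) \<theta> * (\<Prod>j\<in>{..<k} - {l}. D j (f j) \<theta>))"
    if "\<theta> \<in> {0..pi}" for \<theta>
    unfolding h by (rule d_theta_prod[OF _ that]) (rule ext)
  let ?t = "\<lambda>l \<theta>. \<Prod>j<k. (D(l := d_theta \<circ> D l)) j (f j) \<theta>"
  have "?t l \<in> order_terms (Suc s) F" if "l < k" for l
  proof (rule order_termsI[of k f _ "D(l := d_theta \<circ> D l)" "i(l := i l + 1)", OF k f])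
    show "(\<Sum>j<k. (i(l := i l + 1)) j) = Suc s"
      by (simp only: sum_update[OF that] s Suc_eq_plus1)
    show "(D(l := d_theta \<circ> D l)) j \<in> d_ops ((i(l := i l + 1)) j)" if "j < k" for j
      using D[OF that] d_theta_d_ops by auto
  qed
  moreover have "d_theta h \<theta> = (\<Sum>l<k. ?t l \<theta>)" if "\<theta> \<in> {0..pi}" for \<theta>
    unfolding Leibniz[OF that] by (intro sum.cong refl) (simp add: prod_update del: fun_upd_apply)
  ultimately show ?thesis by (rule sum_of_termsI[of k ?t, OF k])
qed

text \<open>The Leibniz expansion is applied twice. For even \<open>s\<close> the intermediate terms
  have odd order, which the grading by \<open>order_terms\<close> admits.\<close>

lemma op_a_order_terms:
  assumes "\<forall>f\<in>F. smooth_polar f" "h \<in> order_terms s F"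
  shows "sum_of_terms (order_terms (s + 2) F) {0..pi} (op_a h)"
proof -
  obtain m \<sigma> where m: "1 \<le> (m::nat)" "\<And>j. j < m \<Longrightarrow> \<sigma> j \<in> order_terms (Suc s) F"
    and \<sigma>: "\<And>\<theta>. \<theta> \<in> {0..pi} \<Longrightarrow> d_theta h \<theta> = (\<Sum>j<m. \<sigma> j \<theta>)"
    using d_theta_order_terms[OF assms] unfolding sum_of_terms_def by blast
  have "op_a h \<theta> = (\<Sum>j<m. d_theta (\<sigma> j) \<theta>)" if "\<theta> \<in> {0..pi}" for \<theta>
    unfolding op_a_def
    by (rule d_theta_sum[OF _ that \<sigma>]) (rule smooth_ext_order_terms[OF assms(1) m(2)])
  moreover have "sum_of_terms (order_terms (s + 2) F) {0..pi} (d_theta (\<sigma> j))" if "j < m" for j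
    using d_theta_order_terms[OF assms(1) m(2)[OF that]] by simp
  ultimately show ?thesis
    by (rule sum_of_terms_sum[OF m(1), of _ _ "\<lambda>j. d_theta (\<sigma> j)", rotated])
qed

text \<open>The identity is stated between the poles, where \<open>op_b\<close> is the plain product
  with \<open>cot\<close>. Evenness of \<open>s\<close> enters for the summands that differentiate a
  factor of odd order.\<close>

lemma cot_d_theta_order_terms:
  assumes "\<forall>f\<in>F. smooth_polar f" "h \<in> order_terms s F" "even s"
  shows "sum_of_terms (order_terms (s + 2) F) {0<..<pi} (\<lambda>\<theta>. cot \<theta> * d_theta h \<theta>)"
proof -
  obtain k i D f where *: "1 \<le> (k::nat) \<and> (\<forall>j<k. f j \<in> F \<and> D j \<in> d_ops (i j)) \<and>
      (\<Sum>j<k. i j) = s \<and> h = (\<lambda>\<theta>. \<Prod>j<k. D j (f j) \<theta>)"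
    by (rule order_termsE[OF assms(2)])
  then have k: "1 \<le> k" and f: "\<And>j. j < k \<Longrightarrow> f j \<in> F" and D: "\<And>j. j < k \<Longrightarrow> D j \<in> d_ops (i j)"
    and s: "(\<Sum>j<k. i j) = s" and h: "h = (\<lambda>\<theta>. \<Prod>j<k. D j (f j) \<theta>)"
    by simp_all
  have ext: "\<exists>g. smooth_ext g (D j (f j))" if "j < k" for j
    using smooth_ext_d_ops[OF D[OF that]] assms(1) f[OF that] by blast
  have Leibniz: "d_theta h \<theta> = (\<Sum>l<k. d_theta (D l (f l)) \<theta> * (\<Prod>j\<in>{..<k} - {l}. D j (f j) \<theta>))"
    if "\<theta> \<in> {0..pi}" for \<theta>
    unfolding h by (rule d_theta_prod[OF _ that]) (rule ext)
  let ?t = "\<lambda>l \<theta>. cot \<theta> * (d_theta (D l (f l)) \<theta> * (\<Prod>j\<in>{..<k} - {l}. D j (f j) \<theta>))"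
  have "cot \<theta> * d_theta h \<theta> = (\<Sum>l<k. ?t l \<theta>)" if "\<theta> \<in> {0<..<pi}" for \<theta>
    using that Leibniz[of \<theta>] by (simp add: sum_distrib_left)
  moreover have "sum_of_terms (order_terms (s + 2) F) {0<..<pi} (?t l)" if l: "l < k" for l
  proof (cases "even (i l)")
    case True
    \<comment> \<open>The cotangent and the new derivative combine into \<open>op_b\<close> on top
      of an even operator; this one factor takes both orders.\<close>
    let ?D = "D(l := op_b \<circ> D l)"
    have "(\<lambda>\<theta>. \<Prod>j<k. ?D j (f j) \<theta>) \<in> order_terms (s + 2) F"
    proof (rule order_termsI[of k f _ ?D "i(l := i l + 2)", OF k f])
      show "(\<Sum>j<k. (i(l := i l + 2)) j) = s + 2"
        by (simp only: sum_update[OF l] s)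
      show "?D j \<in> d_ops ((i(l := i l + 2)) j)" if "j < k" for j
        using D[OF that] op_b_d_ops[OF True D[OF l]] by auto
    qed
    moreover have "?t l \<theta> = (\<Prod>j<k. ?D j (f j) \<theta>)" if "\<theta> \<in> {0<..<pi}" for \<theta>
      unfolding prod_update[OF l] using that by (simp add: op_b_def)
    ultimately show ?thesis by (rule sum_of_terms_base)
  next
    case False
    \<comment> \<open>If \<open>i l\<close> were the only odd order, the total \<open>s\<close>
      would be odd.\<close>
    have "\<exists>m. m < k \<and> m \<noteq> l \<and> odd (i m)"
    proof (rule ccontr)
      assume "\<not> ?thesis"
      then have "even (\<Sum>j\<in>{..<k} - {l}. i j)"
        by (intro dvd_sum) auto
      moreover have "s = i l + (\<Sum>j\<in>{..<k} - {l}. i j)"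
        using l s sum.remove[of "{..<k}" l i] by simp
      ultimately show False using False assms(3) by simp
    qed
    then obtain m where m: "m < k" "m \<noteq> l" "odd (i m)" by blast
    obtain P where P: "D m = d_theta \<circ> P" "op_b \<circ> P \<in> d_ops (Suc (i m))"
      using op_b_odd_d_ops[OF m(3) D[OF m(1)]] .
    \<comment> \<open>Factor \<open>l\<close> takes the derivative and factor \<open>m\<close> takes
      the cotangent; each gains one order.\<close>
    let ?D = "(D(l := d_theta \<circ> D l))(m := op_b \<circ> P)"
    let ?i = "i(l := i l + 1)"
    have "(\<lambda>\<theta>. \<Prod>j<k. ?D j (f j) \<theta>) \<in> order_terms (s + 2) F"
    proof (rule order_termsI[of k f _ ?D "?i(m := ?i m + 1)", OF k f])
      show "(\<Sum>j<k. (?i(m := ?i m + 1)) j) = s + 2"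
        by (simp only: sum_update[OF l] sum_update[OF m(1)] s add.assoc one_add_one)
      show "?D j \<in> d_ops ((?i(m := ?i m + 1)) j)" if "j < k" for j
        using D[OF that] P(2) m(2) d_theta_d_ops[OF D[OF l]] by auto
    qed
    moreover have "?t l \<theta> = (\<Prod>j<k. ?D j (f j) \<theta>)" if "\<theta> \<in> {0<..<pi}" for \<theta>
    proof -
      have "d_theta (D l (f l)) \<theta> * (\<Prod>j\<in>{..<k} - {l}. D j (f j) \<theta>)
          = (\<Prod>j<k. (D(l := d_theta \<circ> D l)) j (f j) \<theta>)"
        by (simp only: prod_update[OF l] o_apply)
      also have "\<dots> = D m (f m) \<theta> * (\<Prod>j\<in>{..<k} - {m}. (D(l := d_theta \<circ> D l)) j (f j) \<theta>)"
        using m(1,2) by (subst prod.remove[of _ m]) auto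
      finally show ?thesis
        unfolding prod_update[OF m(1)] using that by (simp add: P(1) op_b_def del: fun_upd_apply)
    qed
    ultimately show ?thesis by (rule sum_of_terms_base)
  qed
  ultimately show ?thesis
    by (rule sum_of_terms_sum[OF k, of _ _ ?t, rotated])
qed

text \<open>The terms found between the poles are continuous on the closed interval, so the identity
  extends to the limit values that define \<open>op_b\<close> at the poles.\<close>

lemma op_b_order_terms:
  assumes "\<forall>f\<in>F. smooth_polar f" "h \<in> order_terms s F" "even s"
  shows "sum_of_terms (order_terms (s + 2) F) {0..pi} (op_b h)"
proof -
  obtain m \<sigma> where m: "1 \<le> (m::nat)" "\<And>j. j < m \<Longrightarrow> \<sigma> j \<in> order_terms (s + 2) F"
    and \<sigma>: "\<And>\<theta>. \<theta> \<in> {0<..<pi} \<Longrightarrow> cot \<theta> * d_theta h \<theta> = (\<Sum>j<m. \<sigma> j \<theta>)"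
    using cot_d_theta_order_terms[OF assms] unfolding sum_of_terms_def by blast
  have "continuous_on {0..pi} (\<sigma> j)" if "j < m" for j
    using smooth_ext_order_terms[OF assms(1) m(2)[OF that]] smooth_ext_continuous by blast
  then have cont: "continuous_on {0..pi} (\<lambda>\<theta>. \<Sum>j<m. \<sigma> j \<theta>)"
    by (intro continuous_on_sum) simp
  show ?thesis
    by (rule sum_of_termsI[OF m(1), of \<sigma>]) (rule m(2), assumption, rule op_b_eqI[OF cont \<sigma>])
qed

theorem lemmaA3:
  fixes F :: "(real \<Rightarrow> real) set" and n :: nat and \<tau> :: "real \<Rightarrow> real"
    and c :: "(real \<Rightarrow> real) \<Rightarrow> real \<Rightarrow> real"
  assumes "\<forall>f\<in>F. smooth_axisymmetric f"
    and "\<tau> \<in> tau_terms n F"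
    and "c \<in> {op_a, op_b}"
  shows "\<exists>(m::nat) \<sigma>. 1 \<le> m \<and> (\<forall>j<m. \<sigma> j \<in> tau_terms (n + 1) F) \<and>
           (\<forall>\<theta>\<in>{0..pi}. c \<tau> \<theta> = (\<Sum>j<m. \<sigma> j \<theta>))"
proof -
  have F: "\<forall>f\<in>F. smooth_polar f"
    using assms(1) smooth_axisymmetric_imp_smooth_polar by blast
  have \<tau>: "\<tau> \<in> order_terms (2 * n) F"
    using assms(2) by (simp add: tau_terms_eq)
  have "sum_of_terms (order_terms (2 * n + 2) F) {0..pi} (c \<tau>)"
    using assms(3) op_a_order_terms[OF F \<tau>] op_b_order_terms[OF F \<tau>] by auto
  then show ?thesis
    by (simp add: sum_of_terms_def tau_terms_eq)
qed

end
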